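(* Let $\mathbf{A}\in\mathbb{R}^{N\times N}$, $\mathbf{B}\in\mathbb{R}^{N\times m}$, $\mathbf{C}\in\mathbb{R}^{n\times N}$ define the discrete-time system $\mathbf{x}_k=\mathbf{A}\mathbf{x}_{k-1}+\mathbf{B}\mathbf{u}_k$, $\mathbf{y}_k=\mathbf{C}\mathbf{x}_k$, and let $0<s\le m$ be an integer. If the system is output $s$-sparse controllable, then $$\operatorname{rank}(\mathbf{C}\mathbf{W})=n\quad\text{and}\quad \max_{0\le i\le N-1}\frac{\sum_{j=0}^{i}R_j}{i+1}\le s.$$ Conversely, if $$\operatorname{rank}(\mathbf{C}\mathbf{W})=n\quad\text{and}\quad \min\Big\{m,\ \max_{0\le i\le N-1}R_i\Big\}\le s,$$ then the system is output $s$-sparse controllable.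
   Context: A vector in $\mathbb{R}^m$ is $s$-sparse if at most $s$ of its entries are nonzero. The system $(\mathbf{A},\mathbf{B},\mathbf{C})$ with $\mathbf{x}_k=\mathbf{A}\mathbf{x}_{k-1}+\mathbf{B}\mathbf{u}_k$, $\mathbf{y}_k=\mathbf{C}\mathbf{x}_k$ is called output $s$-sparse controllable if there exists an integer $0<K<\infty$ such that for every initial state $\mathbf{x}_0\in\mathbb{R}^N$ and every target $\mathbf{y}_f\in\mathbb{R}^n$ there exist $s$-sparse inputs $\mathbf{u}_1,\dots,\mathbf{u}_K\in\mathbb{R}^m$ with $\mathbf{y}_K=\mathbf{C}\sum_{k=1}^K\mathbf{A}^{K-k}\mathbf{B}\mathbf{u}_k+\mathbf{C}\mathbf{A}^K\mathbf{x}_0=\mathbf{y}_f$ (the supports of the $\mathbf{u}_k$ may differ across $k$). The controllability matrix is $\mathbf{W}=[\mathbf{A}^{N-1}\mathbf{B}\ \ \mathbf{A}^{N-2}\mathbf{B}\ \cdots\ \mathbf{B}]\in\mathbb{R}^{N\times Nm}$, and for integers $i\ge 0$, $R_i=\operatorname{rank}(\mathbf{C}\mathbf{A}^i\mathbf{W})-\operatorname{rank}(\mathbf{C}\mathbf{A}^{i+1}\mathbf{W})$. *)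

theory Defs
  imports "Jordan_Normal_Form.DL_Rank" "Jordan_Normal_Form.Matrix"
begin

definition mrank :: "nat \<Rightarrow> real mat \<Rightarrow> nat" where
  "mrank nr M = vec_space.rank nr M"

(* Controllability matrix W = [A^(N-1) B, A^(N-2) B, ..., B] \<in> R^(N x Nm) *)
definition ctrb_mat :: "real mat \<Rightarrow> real mat \<Rightarrow> nat \<Rightarrow> nat \<Rightarrow> real mat" where
  "ctrb_mat A B N m = mat N (N * m)
     (\<lambda>(r, c). ((A ^\<^sub>m (N - 1 - c div m)) * B) $$ (r, c mod m))"

definition Rdef :: "real mat \<Rightarrow> real mat \<Rightarrow> real mat \<Rightarrow> nat \<Rightarrow> nat \<Rightarrow> nat \<Rightarrow> nat \<Rightarrow> int" where
  "Rdef A B C N m n i =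
     int (mrank n (C * (A ^\<^sub>m i) * ctrb_mat A B N m))
     - int (mrank n (C * (A ^\<^sub>m (Suc i)) * ctrb_mat A B N m))"

definition sparse_vec :: "nat \<Rightarrow> real vec \<Rightarrow> bool" where
  "sparse_vec s u \<longleftrightarrow> card {i. i < dim_vec u \<and> u $ i \<noteq> 0} \<le> s"

fun state :: "real mat \<Rightarrow> real mat \<Rightarrow> real vec \<Rightarrow> (nat \<Rightarrow> real vec) \<Rightarrow> nat \<Rightarrow> real vec" where
  "state A B x0 u 0 = x0"
| "state A B x0 u (Suc k) = A *\<^sub>v state A B x0 u k + B *\<^sub>v u (Suc k)"

definition output_sparse_controllable ::
  "real mat \<Rightarrow> real mat \<Rightarrow> real mat \<Rightarrow> nat \<Rightarrow> nat \<Rightarrow> nat \<Rightarrow> nat \<Rightarrow> bool" where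
  "output_sparse_controllable A B C N m n s \<longleftrightarrow>
     (\<exists>K::nat. 0 < K \<and>
        (\<forall>x0 \<in> carrier_vec N. \<forall>yf \<in> carrier_vec n.
           \<exists>u. (\<forall>k \<in> {1..K}. u k \<in> carrier_vec m \<and> sparse_vec s (u k))
               \<and> C *\<^sub>v state A B x0 u K = yf))"

end

(* Let V_i be the column space of C A^i W. By the Krylov argument it is spanned by all vectors
   C A^j b with j >= i and b a column of B, so V_i is spanned by V_{i+1} and the columns of C A^i B.

   Necessity: the outputs reachable from 0 lie in a finite union, over the possible supports of the
   last i+1 inputs, of subspaces spanned by V_{i+1} and at most s(i+1) vectors. A real vector space
   is not a finite union of proper subspaces, so one of these is R^n, and n - dim V_{i+1} is the
   telescoped sum R_0 + ... + R_i.

   Sufficiency: if R_i <= s, then at most s columns of C A^i B suffice to extend V_{i+1} to V_i, for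
   each i < N. The remainder V_N needs only 1-sparse inputs: since the powers of A act bijectively on
   the Krylov space of A^N b, it is spanned by N consecutive vectors A^(L+r) b for any L >= N, so each
   of the m columns of B gets a time block of length N of its own. *)

theory Submission
  imports Defs
begin

section \<open>Spans in coordinate spaces\<close>

context vec_space
begin

text \<open>The vectors with property \<open>P\<close> form a submodule containing \<open>S\<close>,
  hence one containing \<open>span S\<close>. Later proofs use this induction in place of explicit
  linear combinations.\<close>

lemma span_induct_vec:
  assumes S: "S \<subseteq> carrier_vec n" and v: "v \<in> span S"
    and zero: "P (0\<^sub>v n)"
    and base: "\<And>x. x \<in> S \<Longrightarrow> P x"
    and add: "\<And>x y. x \<in> carrier_vec n \<Longrightarrow> y \<in> carrier_vec n \<Longrightarrow> P x \<Longrightarrow> P y \<Longrightarrow> P (x + y)"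
    and smult: "\<And>c x. x \<in> carrier_vec n \<Longrightarrow> P x \<Longrightarrow> P (c \<cdot>\<^sub>v x)"
  shows "P v"
proof -
  have "submodule class_ring {x \<in> carrier_vec n. P x} V"
    unfolding submodule_def using module_axioms zero add smult by auto
  moreover have "S \<subseteq> {x \<in> carrier_vec n. P x}" using S base by auto
  ultimately have "span S \<subseteq> {x \<in> carrier_vec n. P x}" by (rule span_is_subset[rotated])
  then show ?thesis using v by auto
qed

lemma zero_in_span: "S \<subseteq> carrier_vec n \<Longrightarrow> 0\<^sub>v n \<in> span S"
  using span_is_submodule[of S] unfolding submodule_def by simp

lemma add_in_span:
  "S \<subseteq> carrier_vec n \<Longrightarrow> x \<in> span S \<Longrightarrow> y \<in> span S \<Longrightarrow> x + y \<in> span S"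
  using span_add1 by simp

text \<open>Steinitz exchange: \<open>replacement\<close> supplies a set \<open>C\<close> with
  \<open>card C\<close> at most \<open>card T - card S\<close> over the integers, so this difference
  cannot be negative.\<close>

lemma indep_card_le:
  assumes "lin_indpt S" "S \<subseteq> span T" "finite T" "T \<subseteq> carrier_vec n"
  shows "finite S" "card S \<le> card T"
proof -
  have "S \<subseteq> carrier_vec n" using assms span_closed by auto
  then show "finite S" using li_le_dim(1) fin_dim assms(1) by simp
  then have "\<exists>C. finite C \<and> C \<subseteq> carrier V \<and> C \<subseteq> span T \<and> C \<inter> S = {} \<and>
      int (card C) \<le> int (card T) - int (card S) \<and> span (S \<union> C) = span T"
    using replacement[OF _ assms(3) _ assms(1,2)] assms(4) by simp
  then show "card S \<le> card T" by force
qed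

text \<open>Greedy choice: the elements of \<open>T\<close> are scanned one by one, and each is kept
  only if it is outside the span reached so far. With \<open>S\<close> empty this selects a basis
  from a finite generating set.\<close>

lemma exists_indep_extension:
  assumes "finite T" "lin_indpt S" "S \<subseteq> carrier_vec n" "T \<subseteq> carrier_vec n"
  shows "\<exists>T'\<subseteq>T. S \<inter> T' = {} \<and> lin_indpt (S \<union> T') \<and> span (S \<union> T') = span (S \<union> T)"
  using assms
proof (induction T rule: finite_induct)
  case empty
  then show ?case by auto
next
  case (insert t T)
  then obtain T' where T': "T' \<subseteq> T" "S \<inter> T' = {}" "lin_indpt (S \<union> T')"
    "span (S \<union> T') = span (S \<union> T)"
    by auto
  have c: "S \<union> T' \<subseteq> carrier_vec n" "S \<union> T \<subseteq> carrier_vec n" "t \<in> carrier_vec n"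
    using insert.prems T' by auto
  show ?case
  proof (cases "t \<in> span (S \<union> T')")
    case True
    then have "span (S \<union> T) = span (S \<union> T \<union> {t})"
      using already_in_span[of "S \<union> T" t] T' c by simp
    then show ?thesis using T' by (intro exI[of _ T']) auto
  next
    case False
    then have nt: "t \<notin> S \<union> T'" using span_mem[of "S \<union> T'" t] c by auto
    have indep: "lin_indpt (S \<union> T' \<union> {t})"
      using lin_dep_iff_in_span[of "S \<union> T'" t] T' c nt False by simp
    have "span ((S \<union> T') \<union> {t}) = span ((S \<union> T) \<union> {t})"
      using span_Un[of "S \<union> T'" "S \<union> T" "{t}" "{t}"] T' c by simp
    then show ?thesis using T' nt indep
      by (intro exI[of _ "insert t T'"]) auto
  qed
qed

text \<open>Greedily chosen columns form a maximal independent set of columns, and the rank is the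
  size of such a set.\<close>

lemma rank_basis:
  assumes "M \<in> carrier_mat n k"
  obtains S where "S \<subseteq> set (cols M)" "lin_indpt S" "span S = span (set (cols M))" "card S = rank M"
proof -
  have c: "set (cols M) \<subseteq> carrier_vec n" using assms cols_dim by blast
  obtain S where S: "S \<subseteq> set (cols M)" "lin_indpt S" "span S = span (set (cols M))"
    using exists_indep_extension[of "set (cols M)" "{}"] c finite_lin_indpt2[of "{}"] by auto
  have "maximal S (\<lambda>T. T \<subseteq> set (cols M) \<and> lin_indpt T)"
    unfolding maximal_def
  proof (intro conjI allI impI S)
    \<comment> \<open>Every column lies in \<open>span S\<close>, so the exchange bound prevents an
      independent set of columns containing \<open>S\<close> from being larger than
      \<open>S\<close>.\<close>
    fix B assume B: "S \<subseteq> B \<and> B \<subseteq> set (cols M) \<and> lin_indpt B"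
    then have "B \<subseteq> span S" using S in_own_span[of "set (cols M)"] c by auto
    then have "finite B" "card B \<le> card S"
      using indep_card_le[of B S] B S c finite_subset[OF S(1)] by auto
    then show "B = S" using B card_seteq by blast
  qed
  then have "rank M = card S" using rank_card_indpt assms by blast
  then show ?thesis using S that by auto
qed

text \<open>Otherwise the n+1 vectors \<open>f 0\<close>, ..., \<open>f n\<close> would be
  independent in dimension n. For index 0 the span is that of the empty set.\<close>

lemma exists_in_span_of_previous:
  assumes f: "\<And>i. f i \<in> carrier_vec n"
  shows "\<exists>i\<le>n. f i \<in> span (f ` {..<i})"
proof (rule ccontr)
  assume a: "\<not> ?thesis"
  \<comment> \<open>Independence is a property of sets, so the cardinality is carried along to
    exclude repeated values of \<open>f\<close>.\<close>
  have "lin_indpt (f ` {..<k}) \<and> card (f ` {..<k}) = k" if "k \<le> Suc n" for k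
    using that
  proof (induction k)
    case 0
    then show ?case using finite_lin_indpt2[of "{}"] by auto
  next
    case (Suc k)
    have c: "f ` {..<k} \<subseteq> carrier_vec n" using f by auto
    have ns: "f k \<notin> span (f ` {..<k})" using a Suc.prems by auto
    then have nt: "f k \<notin> f ` {..<k}" using span_mem[of "f ` {..<k}"] c by auto
    have e: "f ` {..<Suc k} = f ` {..<k} \<union> {f k}" by (auto simp: lessThan_Suc)
    have "lin_indpt (f ` {..<Suc k})"
      unfolding e using lin_dep_iff_in_span[of "f ` {..<k}" "f k"] Suc c nt ns f by simp
    then show ?case unfolding e using Suc nt by simp
  qed
  then have "lin_indpt (f ` {..<Suc n})" "card (f ` {..<Suc n}) = Suc n" by auto
  then have "Suc n \<le> dim" using li_le_dim(2)[of "f ` {..<Suc n}"] f fin_dim by auto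
  then show False using dim_is_n by simp
qed

end

text \<open>The dimension is an explicit argument because spans in dimensions N, m and n occur
  together.\<close>

abbreviation vspan :: "nat \<Rightarrow> real vec set \<Rightarrow> real vec set" where
  "vspan n S \<equiv> LinearCombinations.module.span class_ring (module_vec TYPE(real) n) S"

lemma vspan_mono: "S \<subseteq> T \<Longrightarrow> vspan n S \<subseteq> vspan n T"
proof -
  interpret vec_space "TYPE(real)" n .
  show "S \<subseteq> T \<Longrightarrow> vspan n S \<subseteq> vspan n T" by (rule span_is_monotone)
qed

lemma vspan_superset: "S \<subseteq> carrier_vec n \<Longrightarrow> S \<subseteq> vspan n S"
proof -
  interpret vec_space "TYPE(real)" n .
  show "S \<subseteq> carrier_vec n \<Longrightarrow> S \<subseteq> vspan n S" using in_own_span by simp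
qed

lemma vspan_minimal:
  assumes "S \<subseteq> vspan n T" "T \<subseteq> carrier_vec n" shows "vspan n S \<subseteq> vspan n T"
proof -
  interpret vec_space "TYPE(real)" n .
  show ?thesis using span_subsetI assms by simp
qed

lemma vspan_carrier: "S \<subseteq> carrier_vec n \<Longrightarrow> vspan n S \<subseteq> carrier_vec n"
proof -
  interpret vec_space "TYPE(real)" n .
  show "S \<subseteq> carrier_vec n \<Longrightarrow> vspan n S \<subseteq> carrier_vec n" using span_is_subset2 by simp
qed

lemma mult_mat_zero_vec:
  fixes M :: "real mat"
  assumes "M \<in> carrier_mat n k"
  shows "M *\<^sub>v 0\<^sub>v k = 0\<^sub>v n"
  using assms by (intro eq_vecI) auto

text \<open>Linearity in both directions, each by induction over a span. It carries spanning
  statements along powers of A and along B and C.\<close>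

lemma mult_mat_vec_vspan:
  fixes M :: "real mat"
  assumes M: "M \<in> carrier_mat n k" and S: "S \<subseteq> carrier_vec k" 
  shows "(\<lambda>v. M *\<^sub>v v) ` vspan k S = vspan n ((\<lambda>v. M *\<^sub>v v) ` S)"
proof -
  interpret k: vec_space "TYPE(real)" k .
  interpret n: vec_space "TYPE(real)" n .
  have MS: "(\<lambda>v. M *\<^sub>v v) ` S \<subseteq> carrier_vec n" using M S by auto
  have M0: "M *\<^sub>v 0\<^sub>v k = 0\<^sub>v n" using M by (rule mult_mat_zero_vec)
  show ?thesis
  proof (intro equalityI subsetI)
    fix y assume "y \<in> (\<lambda>v. M *\<^sub>v v) ` vspan k S"
    then obtain x where x: "x \<in> k.span S" "y = M *\<^sub>v x" by auto
    from S x(1) have "M *\<^sub>v x \<in> vspan n ((\<lambda>v. M *\<^sub>v v) ` S)"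
    proof (rule k.span_induct_vec)
      show "M *\<^sub>v 0\<^sub>v k \<in> vspan n ((\<lambda>v. M *\<^sub>v v) ` S)"
        using n.zero_in_span MS M0 by simp
    next
      fix x assume "x \<in> S"
      then show "M *\<^sub>v x \<in> vspan n ((\<lambda>v. M *\<^sub>v v) ` S)"
        using vspan_superset[OF MS] by auto
    next
      fix x y :: "real vec" 
      assume "x \<in> carrier_vec k" "y \<in> carrier_vec k"
        "M *\<^sub>v x \<in> vspan n ((\<lambda>v. M *\<^sub>v v) ` S)" "M *\<^sub>v y \<in> vspan n ((\<lambda>v. M *\<^sub>v v) ` S)"
      then show "M *\<^sub>v (x + y) \<in> vspan n ((\<lambda>v. M *\<^sub>v v) ` S)"
        using n.add_in_span MS M by (simp add: mult_add_distrib_mat_vec)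
    next
      fix x :: "real vec" and c :: real
      assume "x \<in> carrier_vec k" "M *\<^sub>v x \<in> vspan n ((\<lambda>v. M *\<^sub>v v) ` S)"
      then show "M *\<^sub>v (c \<cdot>\<^sub>v x) \<in> vspan n ((\<lambda>v. M *\<^sub>v v) ` S)"
        using n.smult_in_span MS M by (simp add: mult_mat_vec)
    qed
    then show "y \<in> vspan n ((\<lambda>v. M *\<^sub>v v) ` S)" using x by simp
  next
    fix y assume y: "y \<in> vspan n ((\<lambda>v. M *\<^sub>v v) ` S)"
    show "y \<in> (\<lambda>v. M *\<^sub>v v) ` vspan k S"
    proof (rule n.span_induct_vec[OF MS y])
      show "0\<^sub>v n \<in> (\<lambda>v. M *\<^sub>v v) ` vspan k S"
        using k.zero_in_span[OF S] M0 by (intro image_eqI[of _ _ "0\<^sub>v k"]) auto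
    next
      fix x assume "x \<in> (\<lambda>v. M *\<^sub>v v) ` S"
      then show "x \<in> (\<lambda>v. M *\<^sub>v v) ` vspan k S" using vspan_superset[OF S] by auto
    next
      fix x y assume "x \<in> (\<lambda>v. M *\<^sub>v v) ` vspan k S" "y \<in> (\<lambda>v. M *\<^sub>v v) ` vspan k S"
      then obtain x' y' where xy: "x = M *\<^sub>v x'" "y = M *\<^sub>v y'" "x' \<in> vspan k S" "y' \<in> vspan k S"
        by auto
      then have "x' \<in> carrier_vec k" "y' \<in> carrier_vec k" using vspan_carrier[OF S] by auto
      then have "x + y = M *\<^sub>v (x' + y')" using xy M by (simp add: mult_add_distrib_mat_vec)
      then show "x + y \<in> (\<lambda>v. M *\<^sub>v v) ` vspan k S" using k.add_in_span S xy by blast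
    next
      fix c x assume "x \<in> (\<lambda>v. M *\<^sub>v v) ` vspan k S"
      then obtain x' where x: "x = M *\<^sub>v x'" "x' \<in> vspan k S" by auto
      then have "x' \<in> carrier_vec k" using vspan_carrier[OF S] by auto
      then have "c \<cdot>\<^sub>v x = M *\<^sub>v (c \<cdot>\<^sub>v x')" using x M by (simp add: mult_mat_vec)
      then show "c \<cdot>\<^sub>v x \<in> (\<lambda>v. M *\<^sub>v v) ` vspan k S" using k.smult_in_span S x by blast
    qed
  qed
qed

text \<open>If \<open>u\<close> lies in \<open>span S\<close> only and \<open>v\<close> does not lie in \<open>span S\<close>, then two of the infinitely many
  points \<open>v + c u\<close> lie in the same other subspace, which then contains \<open>u\<close>.\<close>

lemma finite_union_vspan_eq_carrier:
  assumes "finite F" and "\<And>S. S \<in> F \<Longrightarrow> S \<subseteq> carrier_vec n"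
    and "carrier_vec n \<subseteq> (\<Union>S\<in>F. vspan n S)"
  shows "\<exists>S\<in>F. carrier_vec n \<subseteq> vspan n S"
  using assms
proof (induction F rule: finite_induct)
  case empty
  then show ?case using zero_carrier_vec[of n, where ?'a = real] by blast
next
  case (insert S F)
  interpret vec_space "TYPE(real)" n .
  show ?case
  proof (cases "carrier_vec n \<subseteq> vspan n S \<or> carrier_vec n \<subseteq> (\<Union>S\<in>F. vspan n S)")
    case True
    then show ?thesis using insert by auto
  next
    case False
    then obtain u v where v: "v \<in> carrier_vec n" "v \<notin> vspan n S"
      and u: "u \<in> carrier_vec n" "u \<notin> (\<Union>S\<in>F. vspan n S)" by blast
    have uS: "u \<in> vspan n S" using u insert.prems by auto
    have S: "S \<subseteq> carrier_vec n" using insert.prems by auto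
    have "\<exists>T\<in>F. v + c \<cdot>\<^sub>v u \<in> vspan n T" for c
    proof -
      have "v + c \<cdot>\<^sub>v u \<notin> vspan n S"
      proof
        assume a: "v + c \<cdot>\<^sub>v u \<in> vspan n S"
        have "(-c) \<cdot>\<^sub>v u \<in> vspan n S" using smult_in_span S uS by simp
        then have "(v + c \<cdot>\<^sub>v u) + (-c) \<cdot>\<^sub>v u \<in> vspan n S" using add_in_span S a by simp
        moreover have "(v + c \<cdot>\<^sub>v u) + (-c) \<cdot>\<^sub>v u = v" using u v by (intro eq_vecI) auto
        ultimately show False using v by simp
      qed
      moreover have "v + c \<cdot>\<^sub>v u \<in> carrier_vec n" using u v by simp
      ultimately show ?thesis using insert.prems by auto
    qed
    then obtain T where T: "\<And>c. T c \<in> F" "\<And>c. v + c \<cdot>\<^sub>v u \<in> vspan n (T c)" by metis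
    have "\<not> inj_on T UNIV"
    proof (rule notI)
      assume inj: "inj_on T UNIV"
      have "T ` UNIV \<subseteq> F" using T(1) by blast
      then have "finite (T ` UNIV)" using insert.hyps(1) finite_subset by blast
      from finite_imageD[OF this inj] show False using infinite_UNIV_char_0[where ?'a = real] by blast
    qed
    then obtain c d where cd: "c \<noteq> d" "T c = T d" unfolding inj_on_def by blast
    define X where "X = T c"
    have X: "X \<in> F" "X \<subseteq> carrier_vec n" using T insert.prems X_def by auto
    have "(-1) \<cdot>\<^sub>v (v + d \<cdot>\<^sub>v u) \<in> vspan n X"
      using smult_in_span X T(2)[of d] cd X_def by simp
    then have "(v + c \<cdot>\<^sub>v u) + (-1) \<cdot>\<^sub>v (v + d \<cdot>\<^sub>v u) \<in> vspan n X"
      using add_in_span X T(2)[of c] X_def by simp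
    \<comment> \<open>The difference of the two points is (c - d) u, and c and d are distinct, so
      rescaling recovers u.\<close>
    then have "(1 / (c - d)) \<cdot>\<^sub>v ((v + c \<cdot>\<^sub>v u) + (-1) \<cdot>\<^sub>v (v + d \<cdot>\<^sub>v u)) \<in> vspan n X"
      using smult_in_span X by simp
    moreover have "(1 / (c - d)) \<cdot>\<^sub>v ((v + c \<cdot>\<^sub>v u) + (-1) \<cdot>\<^sub>v (v + d \<cdot>\<^sub>v u)) = u"
      using u v cd by (intro eq_vecI) (auto simp: field_simps)
    ultimately show ?thesis using u X by auto
  qed
qed

section \<open>Krylov spaces\<close>

lemma pow_mat_vec_add:
  fixes A :: "real mat"
  assumes "A \<in> carrier_mat N N" "x \<in> carrier_vec N"
  shows "A ^\<^sub>m (i + j) *\<^sub>v x = A ^\<^sub>m i *\<^sub>v (A ^\<^sub>m j *\<^sub>v x)"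
  using assms(2)
\<comment> \<open>Powers unfold as A^(k+1) = A^k A, so the induction peels off the factor next to
  \<open>x\<close> and replaces \<open>x\<close> by A x.\<close>
proof (induction j arbitrary: x)
  case 0
  then show ?case using assms(1) by simp
next
  case (Suc j)
  have c: "A ^\<^sub>m k \<in> carrier_mat N N" for k using assms(1) by simp
  have "A ^\<^sub>m Suc k *\<^sub>v x = A ^\<^sub>m k *\<^sub>v (A *\<^sub>v x)" for k
    using assoc_mult_mat_vec[OF c assms(1) Suc.prems] by simp
  then show ?case using Suc.IH[of "A *\<^sub>v x"] assms(1) Suc.prems by (metis add_Suc_right mult_mat_vec_carrier)
qed

lemma pow_mat_vec_carrier:
  fixes A :: "real mat"
  assumes "A \<in> carrier_mat N N" "x \<in> carrier_vec N"
  shows "A ^\<^sub>m j *\<^sub>v x \<in> carrier_vec N"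
  using pow_carrier_mat[OF assms(1), of j] assms(2) by (rule mult_mat_vec_carrier)

lemma pow_mat_vec_Suc:
  fixes A :: "real mat"
  assumes "A \<in> carrier_mat N N" "x \<in> carrier_vec N"
  shows "A *\<^sub>v (A ^\<^sub>m j *\<^sub>v x) = A ^\<^sub>m Suc j *\<^sub>v x"
  using pow_mat_vec_add[OF assms, of 1 j] assms by simp

text \<open>Multiplying a linear relation among the vectors A^j x by A^t raises every exponent by
  t.\<close>

lemma krylov_shift:
  fixes A :: "real mat"
  assumes A: "A \<in> carrier_mat N N" and x: "x \<in> carrier_vec N"
    and mem: "A ^\<^sub>m i *\<^sub>v x \<in> vspan N ((\<lambda>j. A ^\<^sub>m j *\<^sub>v x) ` J)"
  shows "A ^\<^sub>m (t + i) *\<^sub>v x \<in> vspan N ((\<lambda>j. A ^\<^sub>m (t + j) *\<^sub>v x) ` J)"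
proof -
  have At: "A ^\<^sub>m t \<in> carrier_mat N N" using A by simp
  have "A ^\<^sub>m t *\<^sub>v (A ^\<^sub>m i *\<^sub>v x) \<in> vspan N ((\<lambda>v. A ^\<^sub>m t *\<^sub>v v) ` (\<lambda>j. A ^\<^sub>m j *\<^sub>v x) ` J)"
    using mem A x pow_mat_vec_carrier by (subst mult_mat_vec_vspan[OF At, symmetric]) auto
  then show ?thesis by (simp add: image_image pow_mat_vec_add[OF A x])
qed

text \<open>This takes the place of Cayley-Hamilton: some A^p x with p <= N depends on the earlier
  powers, and the shifted relation lowers every larger exponent until it is below p.\<close>

lemma krylov_bounded:
  fixes A :: "real mat"
  assumes A: "A \<in> carrier_mat N N" and x: "x \<in> carrier_vec N"
  shows "A ^\<^sub>m t *\<^sub>v x \<in> vspan N ((\<lambda>i. A ^\<^sub>m i *\<^sub>v x) ` {..<N})"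
proof -
  interpret vec_space "TYPE(real)" N .
  have c: "A ^\<^sub>m i *\<^sub>v x \<in> carrier_vec N" for i using A x by (intro mult_mat_vec_carrier) auto
  obtain p where p: "p \<le> N" "A ^\<^sub>m p *\<^sub>v x \<in> span ((\<lambda>i. A ^\<^sub>m i *\<^sub>v x) ` {..<p})"
    using exists_in_span_of_previous[of "\<lambda>i. A ^\<^sub>m i *\<^sub>v x"] c by auto
  have "A ^\<^sub>m t *\<^sub>v x \<in> vspan N ((\<lambda>i. A ^\<^sub>m i *\<^sub>v x) ` {..<p})"
  proof (induction t rule: less_induct)
    case (less t)
    show ?case
    proof (cases "t < p")
      case True
      then show ?thesis using vspan_superset[of "(\<lambda>i. A ^\<^sub>m i *\<^sub>v x) ` {..<p}" N] c by auto
    next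
      case False
      then have "A ^\<^sub>m t *\<^sub>v x \<in> vspan N ((\<lambda>i. A ^\<^sub>m (t - p + i) *\<^sub>v x) ` {..<p})"
        using krylov_shift[OF A x p(2), of "t - p"] by simp
      moreover have "(\<lambda>i. A ^\<^sub>m (t - p + i) *\<^sub>v x) ` {..<p} \<subseteq> vspan N ((\<lambda>i. A ^\<^sub>m i *\<^sub>v x) ` {..<p})"
        using less False by auto
      ultimately show ?thesis using vspan_minimal[of _ N "(\<lambda>i. A ^\<^sub>m i *\<^sub>v x) ` {..<p}"] c by blast
    qed
  qed
  then show ?thesis using p(1) by (meson image_mono lessThan_subset_iff subsetD vspan_mono)
qed

text \<open>The mirror image of the previous reduction: a relation expressing a vector by higher
  powers is used repeatedly, until all exponents are at least L. From there on the shifted forward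
  reduction applies.\<close>

lemma krylov_backward:
  fixes A :: "real mat"
  assumes A: "A \<in> carrier_mat N N" and x: "x \<in> carrier_vec N" and t: "N \<le> t"
  shows "A ^\<^sub>m t *\<^sub>v x \<in> vspan N ((\<lambda>i. A ^\<^sub>m (L + i) *\<^sub>v x) ` {..<N})"
proof -
  interpret vec_space "TYPE(real)" N .
  have c: "A ^\<^sub>m i *\<^sub>v x \<in> carrier_vec N" for i using A x by (intro mult_mat_vec_carrier) auto
  have late: "A ^\<^sub>m (L + i) *\<^sub>v x \<in> vspan N ((\<lambda>i. A ^\<^sub>m (L + i) *\<^sub>v x) ` {..<N})" for i
    using krylov_shift[OF A x krylov_bounded[OF A x]] .
  \<comment> \<open>The sequence is read backwards from A^N x, so the previous members are those
    with larger exponents. As p <= N, the subtraction does not truncate.\<close>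
  obtain p where p: "p \<le> N" "A ^\<^sub>m (N - p) *\<^sub>v x \<in> span ((\<lambda>i. A ^\<^sub>m (N - i) *\<^sub>v x) ` {..<p})"
    using exists_in_span_of_previous[of "\<lambda>i. A ^\<^sub>m (N - i) *\<^sub>v x"] c by auto
  have "(\<lambda>i. A ^\<^sub>m (N - i) *\<^sub>v x) ` {..<p} = (\<lambda>j. A ^\<^sub>m j *\<^sub>v x) ` (\<lambda>i. N - i) ` {..<p}"
    by (simp add: image_image)
  also have "\<dots> \<subseteq> (\<lambda>j. A ^\<^sub>m j *\<^sub>v x) ` {N - p<..}" using p(1) by auto
  finally have q: "A ^\<^sub>m (N - p) *\<^sub>v x \<in> vspan N ((\<lambda>j. A ^\<^sub>m j *\<^sub>v x) ` {N - p<..})"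
    using vspan_mono p(2) by blast
  have "A ^\<^sub>m s *\<^sub>v x \<in> vspan N ((\<lambda>i. A ^\<^sub>m (L + i) *\<^sub>v x) ` {..<N})" if "N \<le> s" for s
    using that
  \<comment> \<open>Each use of the relation strictly raises the exponent, so its distance to L
    shrinks.\<close>
  proof (induction "L - s" arbitrary: s rule: less_induct)
    case less
    show ?case
    proof (cases "L \<le> s")
      case True
      then show ?thesis using late[of "s - L"] by simp
    next
      case False
      \<comment> \<open>The shift that moves exponent N - p to s; it exists because s >= N.\<close>
      define k where "k = s - (N - p)"
      have s: "s = k + (N - p)" using less.prems k_def by simp
      have "A ^\<^sub>m s *\<^sub>v x \<in> vspan N ((\<lambda>j. A ^\<^sub>m (k + j) *\<^sub>v x) ` {N - p<..})"
        using krylov_shift[OF A x q, of k] s by simp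
      moreover have "A ^\<^sub>m (k + j) *\<^sub>v x \<in> vspan N ((\<lambda>i. A ^\<^sub>m (L + i) *\<^sub>v x) ` {..<N})"
        if "N - p < j" for j
        using less.hyps[of "k + j"] less.prems False that s by linarith
      ultimately show ?thesis
        using vspan_minimal[of "(\<lambda>j. A ^\<^sub>m (k + j) *\<^sub>v x) ` {N - p<..}" N
            "(\<lambda>i. A ^\<^sub>m (L + i) *\<^sub>v x) ` {..<N}"] c by blast
    qed
  qed
  then show ?thesis using t .
qed

section \<open>Sparse trajectories\<close>

lemma state_carrier:
  assumes "A \<in> carrier_mat N N" "B \<in> carrier_mat N m" "x \<in> carrier_vec N"
  shows "state A B x u K \<in> carrier_vec N"
proof (cases K)
  case 0
  then show ?thesis using assms(3) by simp
next
  case (Suc k)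
  \<comment> \<open>A sum of vectors takes its dimension from the second summand, here a product
    with \<open>B\<close>.\<close>
  then show ?thesis using carrier_matD(1)[OF assms(2)] by (intro carrier_vecI) simp
qed

text \<open>Superposition: together with homogeneity, the state is linear in the pair of initial
  state and input sequence.\<close>

lemma state_add:
  assumes "A \<in> carrier_mat N N" "B \<in> carrier_mat N m" "x \<in> carrier_vec N" "y \<in> carrier_vec N"
    and "\<And>k. u k \<in> carrier_vec m" "\<And>k. w k \<in> carrier_vec m"
  shows "state A B (x + y) (\<lambda>k. u k + w k) K = state A B x u K + state A B y w K"
proof (induction K)
  case (Suc K)
  define a b where "a = state A B x u K" and "b = state A B y w K"
  have ab: "a \<in> carrier_vec N" "b \<in> carrier_vec N"
    unfolding a_def b_def using assms state_carrier by auto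
  have c: "A *\<^sub>v a \<in> carrier_vec N" "A *\<^sub>v b \<in> carrier_vec N"
    "B *\<^sub>v u (Suc K) \<in> carrier_vec N" "B *\<^sub>v w (Suc K) \<in> carrier_vec N"
    using ab mult_mat_vec_carrier[OF assms(1)] mult_mat_vec_carrier[OF assms(2)] assms(5,6) by auto
  have "state A B (x + y) (\<lambda>k. u k + w k) (Suc K) = A *\<^sub>v (a + b) + B *\<^sub>v (u (Suc K) + w (Suc K))"
    using Suc a_def b_def by simp
  also have "\<dots> = (A *\<^sub>v a + A *\<^sub>v b) + (B *\<^sub>v u (Suc K) + B *\<^sub>v w (Suc K))"
    using mult_add_distrib_mat_vec[OF assms(1) ab] mult_add_distrib_mat_vec[OF assms(2,5,6)] by simp
  also have "\<dots> = (A *\<^sub>v a + B *\<^sub>v u (Suc K)) + (A *\<^sub>v b + B *\<^sub>v w (Suc K))"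
    using c by (intro eq_vecI) (auto simp del: index_mult_mat_vec)
  finally show ?case by (simp add: a_def b_def)
qed simp

lemma state_smult:
  assumes "A \<in> carrier_mat N N" "B \<in> carrier_mat N m" "x \<in> carrier_vec N"
    and "\<And>k. u k \<in> carrier_vec m"
  shows "state A B (c \<cdot>\<^sub>v x) (\<lambda>k. c \<cdot>\<^sub>v u k) K = c \<cdot>\<^sub>v state A B x u K"
proof (induction K)
  case (Suc K)
  define a where "a = state A B x u K"
  have a: "a \<in> carrier_vec N" unfolding a_def using assms state_carrier by auto
  have c: "A *\<^sub>v a \<in> carrier_vec N" "B *\<^sub>v u (Suc K) \<in> carrier_vec N"
    using a mult_mat_vec_carrier[OF assms(1)] mult_mat_vec_carrier[OF assms(2)] assms(4) by auto
  have "state A B (c \<cdot>\<^sub>v x) (\<lambda>k. c \<cdot>\<^sub>v u k) (Suc K) = A *\<^sub>v (c \<cdot>\<^sub>v a) + B *\<^sub>v (c \<cdot>\<^sub>v u (Suc K))"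
    using Suc a_def by simp
  also have "\<dots> = c \<cdot>\<^sub>v (A *\<^sub>v a + B *\<^sub>v u (Suc K))"
    using mult_mat_vec[OF assms(1) a] mult_mat_vec[OF assms(2,4)] smult_add_distrib_vec[OF c] by simp
  finally show ?case by (simp add: a_def)
qed simp

lemma state_zero_input:
  assumes "A \<in> carrier_mat N N" "B \<in> carrier_mat N m" "x \<in> carrier_vec N"
  shows "state A B x (\<lambda>_. 0\<^sub>v m) K = A ^\<^sub>m K *\<^sub>v x"
proof (induction K)
  case 0
  then show ?case using assms by simp
next
  case (Suc K)
  have "B *\<^sub>v 0\<^sub>v m = 0\<^sub>v N" using assms by (intro eq_vecI) auto
  moreover have "A ^\<^sub>m Suc K *\<^sub>v x \<in> carrier_vec N"
    using assms pow_carrier_mat[of A N "Suc K"] by (intro mult_mat_vec_carrier)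
  ultimately show ?case using Suc pow_mat_vec_Suc[OF assms(1,3), of K] by simp
qed

text \<open>Superposition of the free response of \<open>x\<close> under zero input and the forced
  response from the zero state.\<close>

lemma state_decompose:
  assumes "A \<in> carrier_mat N N" "B \<in> carrier_mat N m" "x \<in> carrier_vec N"
    and "\<And>k. u k \<in> carrier_vec m"
  shows "state A B x u K = A ^\<^sub>m K *\<^sub>v x + state A B (0\<^sub>v N) u K"
proof -
  have "state A B (x + 0\<^sub>v N) (\<lambda>k. 0\<^sub>v m + u k) K = state A B x (\<lambda>_. 0\<^sub>v m) K + state A B (0\<^sub>v N) u K"
    using assms by (intro state_add) auto
  then show ?thesis using assms state_zero_input by simp
qed

lemma mult_unit_vec_col:
  fixes B :: "real mat"
  assumes "B \<in> carrier_mat N m" "c < m"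
  shows "B *\<^sub>v unit_vec m c = col B c"
  using assms by (intro eq_vecI) auto

text \<open>Inputs are numbered from 1, so the impulse sits at time \<open>Suc l\<close>. The state
  is zero up to time \<open>l\<close>; after the impulse the column evolves freely.\<close>

lemma state_impulse:
  assumes A: "A \<in> carrier_mat N N" and B: "B \<in> carrier_mat N m" and c: "c < m"
  shows "state A B (0\<^sub>v N) (\<lambda>k. if k = Suc l then unit_vec m c else 0\<^sub>v m) K =
    (if K \<le> l then 0\<^sub>v N else A ^\<^sub>m (K - Suc l) *\<^sub>v col B c)"
proof (induction K)
  case (Suc K)
  have z: "A *\<^sub>v 0\<^sub>v N = 0\<^sub>v N" "B *\<^sub>v 0\<^sub>v m = 0\<^sub>v N" using A B by (auto intro!: eq_vecI)
  have b: "col B c \<in> carrier_vec N" using B by auto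
  consider "Suc K \<le> l" | "K = l" | "l < K" by linarith
  then show ?case
  proof cases
    case 3
    then have "Suc K - Suc l = Suc (K - Suc l)" by simp
    moreover have "A ^\<^sub>m Suc (K - Suc l) *\<^sub>v col B c \<in> carrier_vec N"
      using A b pow_carrier_mat by (intro mult_mat_vec_carrier)
    ultimately show ?thesis using 3 Suc z pow_mat_vec_Suc[OF A b, of "K - Suc l"] by simp
  qed (use Suc z A B b mult_unit_vec_col[OF B c] in auto)
qed simp

text \<open>The exponent \<open>j\<close> is the lag: input \<open>u (K - j)\<close> is carried to
  time \<open>K\<close> by A^j. One more step raises old lags by one and adds the columns hit by the
  newest input at lag 0.\<close>

lemma state_in_vspan:
  assumes A: "A \<in> carrier_mat N N" and B: "B \<in> carrier_mat N m"
    and u: "\<And>k. k \<in> {1..K} \<Longrightarrow> u k \<in> carrier_vec m"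
  shows "state A B (0\<^sub>v N) u K \<in>
    vspan N {A ^\<^sub>m j *\<^sub>v col B c | j c. j < K \<and> c < m \<and> u (K - j) $ c \<noteq> 0}"
  using u
proof (induction K)
  case 0
  interpret vec_space "TYPE(real)" N .
  show ?case using zero_in_span[of "{}"] by simp
next
  case (Suc K)
  interpret vec_space "TYPE(real)" N .
  let ?S = "\<lambda>K. {A ^\<^sub>m j *\<^sub>v col B c | j c. j < K \<and> c < m \<and> u (K - j) $ c \<noteq> 0}"
  have b: "col B c \<in> carrier_vec N" for c using B by auto
  have Sc: "?S K \<subseteq> carrier_vec N" for K
    using pow_mat_vec_carrier[OF A b] by blast
  have "A *\<^sub>v state A B (0\<^sub>v N) u K \<in> vspan N ((\<lambda>v. A *\<^sub>v v) ` ?S K)"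
    using mult_mat_vec_vspan[OF A Sc, of K] Suc by auto
  moreover have "(\<lambda>v. A *\<^sub>v v) ` ?S K \<subseteq> ?S (Suc K)"
  proof
    fix y assume "y \<in> (\<lambda>v. A *\<^sub>v v) ` ?S K"
    then obtain j c where "y = A *\<^sub>v (A ^\<^sub>m j *\<^sub>v col B c)" "j < K" "c < m" "u (K - j) $ c \<noteq> 0" by auto
    then have "y = A ^\<^sub>m Suc j *\<^sub>v col B c \<and> Suc j < Suc K \<and> c < m \<and> u (Suc K - Suc j) $ c \<noteq> 0"
      using pow_mat_vec_Suc[OF A b] by simp
    then show "y \<in> ?S (Suc K)" by blast
  qed
  ultimately have 1: "A *\<^sub>v state A B (0\<^sub>v N) u K \<in> vspan N (?S (Suc K))"
    using vspan_mono by blast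
  have uc: "u (Suc K) \<in> carrier_vec m" using Suc.prems by simp
  let ?U = "{unit_vec m c | c. c < m \<and> u (Suc K) $ c \<noteq> 0}"
  have "u (Suc K) \<in> vspan m ?U"
  proof -
    interpret m: vec_space "TYPE(real)" m .
    have Uc: "?U \<subseteq> carrier_vec m" by auto
    \<comment> \<open>Expansion in unit vectors, built up through truncations: entry
      \<open>l\<close> contributes a support vector or zero.\<close>
    have "vec m (\<lambda>i. if i < l then u (Suc K) $ i else 0) \<in> m.span ?U" if "l \<le> m" for l
      using that
    proof (induction l)
      case 0
      have "vec m (\<lambda>i. if i < 0 then u (Suc K) $ i else 0) = 0\<^sub>v m" by (intro eq_vecI) auto
      then show ?case using m.zero_in_span[OF Uc] by simp
    next
      case (Suc l)
      have e: "vec m (\<lambda>i. if i < Suc l then u (Suc K) $ i else 0) =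
        vec m (\<lambda>i. if i < l then u (Suc K) $ i else 0) + (u (Suc K) $ l) \<cdot>\<^sub>v unit_vec m l"
        using Suc by (intro eq_vecI) (auto simp: less_Suc_eq)
      have "(u (Suc K) $ l) \<cdot>\<^sub>v unit_vec m l \<in> m.span ?U"
      proof (cases "u (Suc K) $ l = 0")
        case True
        then have "(u (Suc K) $ l) \<cdot>\<^sub>v unit_vec m l = 0\<^sub>v m" by (intro eq_vecI) auto
        then show ?thesis using m.zero_in_span[OF Uc] by simp
      next
        case False
        then have "unit_vec m l \<in> ?U" using Suc.prems by auto
        then have "unit_vec m l \<in> m.span ?U" using vspan_superset[OF Uc] by (rule rev_subsetD)
        then show ?thesis by (rule m.smult_in_span[OF Uc])
      qed
      then show ?case unfolding e using m.add_in_span[OF Uc] Suc by simp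
    qed
    from this[of m] have "vec m (\<lambda>i. if i < m then u (Suc K) $ i else 0) \<in> m.span ?U" by simp
    moreover have "vec m (\<lambda>i. if i < m then u (Suc K) $ i else 0) = u (Suc K)"
      using uc by (intro eq_vecI) auto
    ultimately show ?thesis by simp
  qed
  then have "B *\<^sub>v u (Suc K) \<in> vspan N ((\<lambda>v. B *\<^sub>v v) ` ?U)"
    by (subst mult_mat_vec_vspan[OF B, symmetric]) auto
  moreover have "(\<lambda>v. B *\<^sub>v v) ` ?U \<subseteq> ?S (Suc K)"
  proof
    fix y assume "y \<in> (\<lambda>v. B *\<^sub>v v) ` ?U"
    then obtain c where c: "c < m" "u (Suc K) $ c \<noteq> 0" "y = B *\<^sub>v unit_vec m c" by auto
    then have "y = A ^\<^sub>m 0 *\<^sub>v col B c" using mult_unit_vec_col[OF B] A b by simp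
    then show "y \<in> ?S (Suc K)" using c(1,2) by fastforce
  qed
  ultimately have "B *\<^sub>v u (Suc K) \<in> vspan N (?S (Suc K))" using vspan_mono by blast
  then show ?case using 1 add_in_span[OF Sc] by simp
qed

text \<open>Converse of the previous inclusion for a prescribed support \<open>P j\<close> at each
  lag \<open>j\<close>: impulses reach the generators and superposition reaches their span.\<close>

lemma vspan_reached_by_state:
  assumes A: "A \<in> carrier_mat N N" and B: "B \<in> carrier_mat N m"
    and P: "\<And>j. P j \<subseteq> {..<m}"
    and v: "v \<in> vspan N {A ^\<^sub>m j *\<^sub>v col B c | j c. j < K \<and> c \<in> P j}"
  shows "\<exists>u. (\<forall>k. u k \<in> carrier_vec m \<and> {i. i < m \<and> u k $ i \<noteq> 0} \<subseteq> P (K - k)) \<and>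
    state A B (0\<^sub>v N) u K = v"
proof -
  interpret vec_space "TYPE(real)" N .
  \<comment> \<open>Containment in fixed supports is preserved by sums and multiples of inputs,
    whereas s-sparsity alone is not preserved by sums.\<close>
  define good where "good u \<longleftrightarrow> (\<forall>k. u k \<in> carrier_vec m \<and> {i. i < m \<and> u k $ i \<noteq> 0} \<subseteq> P (K - k))" for u :: "nat \<Rightarrow> real vec"
  let ?S = "{A ^\<^sub>m j *\<^sub>v col B c | j c. j < K \<and> c \<in> P j}"
  have b: "col B c \<in> carrier_vec N" for c using B by auto
  have Sc: "?S \<subseteq> carrier_vec N"
    using pow_mat_vec_carrier[OF A b] by blast
  have "\<exists>u. good u \<and> state A B (0\<^sub>v N) u K = v"
  proof (rule span_induct_vec[OF Sc v])
    have "state A B (0\<^sub>v N) (\<lambda>_. 0\<^sub>v m) K = 0\<^sub>v N"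
      using state_zero_input[OF A B, of "0\<^sub>v N"] pow_carrier_mat[OF A, of K]
        mult_mat_zero_vec by simp
    then show "\<exists>u. good u \<and> state A B (0\<^sub>v N) u K = 0\<^sub>v N"
      by (intro exI[of _ "\<lambda>_. 0\<^sub>v m"]) (auto simp: good_def)
  next
    fix x assume "x \<in> ?S"
    then obtain j c where x: "x = A ^\<^sub>m j *\<^sub>v col B c" "j < K" "c \<in> P j" by auto
    \<comment> \<open>An impulse at time \<open>Suc l\<close> = K - j has lag exactly
      \<open>j\<close> at time \<open>K\<close>.\<close>
    define l where "l = K - Suc j"
    have l: "K - Suc l = j" "\<not> K \<le> l" using x(2) l_def by auto
    have "c < m" using x P by auto
    then have "state A B (0\<^sub>v N) (\<lambda>k. if k = Suc l then unit_vec m c else 0\<^sub>v m) K = x"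
      using state_impulse[OF A B, of c l K] l x by simp
    then show "\<exists>u. good u \<and> state A B (0\<^sub>v N) u K = x"
      using x(3) l(1) \<open>c < m\<close>
      by (intro exI[of _ "\<lambda>k. if k = Suc l then unit_vec m c else 0\<^sub>v m"])
        (auto simp: good_def split: if_splits)
  next
    fix x y assume "\<exists>u. good u \<and> state A B (0\<^sub>v N) u K = x" "\<exists>u. good u \<and> state A B (0\<^sub>v N) u K = y"
    then obtain u w where u: "good u" "state A B (0\<^sub>v N) u K = x"
      and w: "good w" "state A B (0\<^sub>v N) w K = y" by blast
    have uw: "\<And>k. u k \<in> carrier_vec m" "\<And>k. w k \<in> carrier_vec m" using u(1) w(1) unfolding good_def by blast+
    have "state A B (0\<^sub>v N + 0\<^sub>v N) (\<lambda>k. u k + w k) K = x + y"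
      using state_add[of A N B m "0\<^sub>v N" "0\<^sub>v N" u w K, OF A B zero_carrier_vec zero_carrier_vec uw] unfolding u(2) w(2) .
    then have "state A B (0\<^sub>v N) (\<lambda>k. u k + w k) K = x + y"
      by simp
    moreover have "good (\<lambda>k. u k + w k)"
      unfolding good_def
    proof (intro allI conjI subsetI)
      fix k i assume i: "i \<in> {i. i < m \<and> (u k + w k) $ i \<noteq> 0}"
      then have "(u k + w k) $ i = u k $ i + w k $ i" using carrier_vecD[OF uw(2)[of k]] by auto
      then have "u k $ i \<noteq> 0 \<or> w k $ i \<noteq> 0" using i by auto
      then show "i \<in> P (K - k)" using u(1) w(1) i unfolding good_def by blast
    qed (use uw in simp)
    ultimately show "\<exists>u. good u \<and> state A B (0\<^sub>v N) u K = x + y" by blast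
  next
    fix x c assume "\<exists>u. good u \<and> state A B (0\<^sub>v N) u K = x"
    then obtain u where u: "good u" "state A B (0\<^sub>v N) u K = x" by blast
    have uc: "\<And>k. u k \<in> carrier_vec m" using u(1) unfolding good_def by blast
    have "state A B (c \<cdot>\<^sub>v 0\<^sub>v N) (\<lambda>k. c \<cdot>\<^sub>v u k) K = c \<cdot>\<^sub>v x"
      using state_smult[of A N B m "0\<^sub>v N" u c K, OF A B zero_carrier_vec uc] unfolding u(2) .
    then have "state A B (0\<^sub>v N) (\<lambda>k. c \<cdot>\<^sub>v u k) K = c \<cdot>\<^sub>v x"
      by simp
    moreover have "good (\<lambda>k. c \<cdot>\<^sub>v u k)"
      unfolding good_def
    proof (intro allI conjI subsetI)
      fix k i assume i: "i \<in> {i. i < m \<and> (c \<cdot>\<^sub>v u k) $ i \<noteq> 0}"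
      then have "u k $ i \<noteq> 0" using carrier_vecD[OF uc[of k]] by auto
      then show "i \<in> P (K - k)" using u(1) i unfolding good_def by blast
    qed (use uc in simp)
    ultimately show "\<exists>u. good u \<and> state A B (0\<^sub>v N) u K = c \<cdot>\<^sub>v x" by blast
  qed
  then show ?thesis unfolding good_def .
qed

section \<open>Column spaces of the output controllability matrices\<close>

text \<open>Column \<open>c\<close> of the Markov parameter C A^j B.\<close>

definition markov_col :: "real mat \<Rightarrow> real mat \<Rightarrow> real mat \<Rightarrow> nat \<Rightarrow> nat \<Rightarrow> real vec" where
  "markov_col A B C j c = C *\<^sub>v (A ^\<^sub>m j *\<^sub>v col B c)"

text \<open>Generators of V_i. With no upper bound on the exponent, passing from i+1 to i just adds
  the columns of C A^i B.\<close>

definition markov_tail :: "real mat \<Rightarrow> real mat \<Rightarrow> real mat \<Rightarrow> nat \<Rightarrow> nat \<Rightarrow> real vec set" where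
  "markov_tail A B C m i = {markov_col A B C j c | j c. i \<le> j \<and> c < m}"

lemma col_ctrb_mat:
  assumes A: "A \<in> carrier_mat N N" and B: "B \<in> carrier_mat N m" and k: "k < N * m"
  shows "col (ctrb_mat A B N m) k = A ^\<^sub>m (N - 1 - k div m) *\<^sub>v col B (k mod m)"
proof -
  have m: "k mod m < m" using k by (cases m) auto
  have dim: "dim_row (A ^\<^sub>m (N - 1 - k div m)) = N" using pow_carrier_mat[OF A] by (rule carrier_matD)
  have "col (ctrb_mat A B N m) k = col (A ^\<^sub>m (N - 1 - k div m) * B) (k mod m)"
    unfolding ctrb_mat_def using k dim carrier_matD[OF B] m
    by (intro eq_vecI) (simp_all del: pow_mat_dim)
  also have "\<dots> = A ^\<^sub>m (N - 1 - k div m) *\<^sub>v col B (k mod m)"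
    using A B m by (intro col_mult2[of _ N N _ m]) auto
  finally show ?thesis .
qed

context
  fixes A B C :: "real mat" and N m n :: nat
  assumes A: "A \<in> carrier_mat N N" and B: "B \<in> carrier_mat N m" and C: "C \<in> carrier_mat n N"
begin

lemma col_carrier: "col B c \<in> carrier_vec N"
  using B by auto

lemma power_col_carrier: "A ^\<^sub>m j *\<^sub>v col B c \<in> carrier_vec N"
  using A col_carrier by (rule pow_mat_vec_carrier)

lemma markov_col_carrier: "markov_col A B C j c \<in> carrier_vec n"
  unfolding markov_col_def using C power_col_carrier by (rule mult_mat_vec_carrier)

lemma markov_tail_carrier: "markov_tail A B C m i \<subseteq> carrier_vec n"
  unfolding markov_tail_def using markov_col_carrier by blast

lemma output_ctrb_carrier: "C * A ^\<^sub>m i * ctrb_mat A B N m \<in> carrier_mat n (N * m)"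
  using A C by (auto simp: ctrb_mat_def)

lemma cols_output_ctrb:
  "set (cols (C * A ^\<^sub>m i * ctrb_mat A B N m)) = {markov_col A B C (i + j) c | j c. j < N \<and> c < m}"
proof -
  have CA: "C * A ^\<^sub>m i \<in> carrier_mat n N" using A C by simp
  have W: "ctrb_mat A B N m \<in> carrier_mat N (N * m)" by (simp add: ctrb_mat_def)
  have col: "col (C * A ^\<^sub>m i * ctrb_mat A B N m) k = markov_col A B C (i + (N - 1 - k div m)) (k mod m)"
    if k: "k < N * m" for k
  proof -
    have "col (C * A ^\<^sub>m i * ctrb_mat A B N m) k
      = (C * A ^\<^sub>m i) *\<^sub>v (A ^\<^sub>m (N - 1 - k div m) *\<^sub>v col B (k mod m))"
      using col_mult2[OF CA W k] col_ctrb_mat[OF A B k] by simp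
    also have "\<dots> = C *\<^sub>v (A ^\<^sub>m i *\<^sub>v (A ^\<^sub>m (N - 1 - k div m) *\<^sub>v col B (k mod m)))"
      using A C power_col_carrier by (intro assoc_mult_mat_vec[of _ n N _ N]) auto
    finally show ?thesis unfolding markov_col_def pow_mat_vec_add[OF A col_carrier] .
  qed
  have "set (cols (C * A ^\<^sub>m i * ctrb_mat A B N m))
    = (\<lambda>k. col (C * A ^\<^sub>m i * ctrb_mat A B N m) k) ` {..<N * m}"
    using output_ctrb_carrier[of i] by (auto simp: cols_def atLeast0LessThan)
  also have "\<dots> = {markov_col A B C (i + j) c | j c. j < N \<and> c < m}"
  proof (intro equalityI subsetI)
    fix x assume "x \<in> (\<lambda>k. col (C * A ^\<^sub>m i * ctrb_mat A B N m) k) ` {..<N * m}"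
    then obtain k where k: "k < N * m" "x = markov_col A B C (i + (N - 1 - k div m)) (k mod m)"
      using col by auto
    then have "N - 1 - k div m < N" "k mod m < m" by (cases m; cases N; auto)+
    then show "x \<in> {markov_col A B C (i + j) c | j c. j < N \<and> c < m}" using k by blast
  next
    fix x assume "x \<in> {markov_col A B C (i + j) c | j c. j < N \<and> c < m}"
    then obtain j c where x: "x = markov_col A B C (i + j) c" "j < N" "c < m" by auto
    \<comment> \<open>The blocks of W are ordered by decreasing powers of A, so power
      \<open>j\<close> is in block N - 1 - j, counted from 0.\<close>
    define k where "k = (N - 1 - j) * m + c"
    have "k < (N - 1 - j) * m + m" using x k_def by simp
    also have "\<dots> = Suc (N - 1 - j) * m" by simp
    also have "\<dots> \<le> N * m" using x by (intro mult_le_mono) auto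
    finally have k: "k < N * m" .
    have "k div m = N - 1 - j" "k mod m = c" using x(3) by (simp_all add: k_def)
    then have "x = col (C * A ^\<^sub>m i * ctrb_mat A B N m) k" using col[OF k] x by simp
    then show "x \<in> (\<lambda>k. col (C * A ^\<^sub>m i * ctrb_mat A B N m) k) ` {..<N * m}" using k by auto
  qed
  finally show ?thesis .
qed

text \<open>The matrix has only the exponents i, ..., i+N-1. The shifted Krylov reduction, mapped by
  C, shows that higher exponents add nothing to the span.\<close>

lemma vspan_cols_output_ctrb:
  "vspan n (set (cols (C * A ^\<^sub>m i * ctrb_mat A B N m))) = vspan n (markov_tail A B C m i)"
proof
  let ?G = "{markov_col A B C (i + j) c | j c. j < N \<and> c < m}"
  have G: "?G \<subseteq> carrier_vec n" using markov_col_carrier by blast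
  have "?G \<subseteq> markov_tail A B C m i" unfolding markov_tail_def by (auto intro: le_add1)
  then show "vspan n (set (cols (C * A ^\<^sub>m i * ctrb_mat A B N m))) \<subseteq> vspan n (markov_tail A B C m i)"
    unfolding cols_output_ctrb by (rule vspan_mono)
  have "markov_tail A B C m i \<subseteq> vspan n ?G"
  proof
    fix x assume "x \<in> markov_tail A B C m i"
    then obtain j c where x: "x = C *\<^sub>v (A ^\<^sub>m j *\<^sub>v col B c)" "i \<le> j" "c < m"
      unfolding markov_tail_def markov_col_def by auto
    have "A ^\<^sub>m (i + (j - i)) *\<^sub>v col B c \<in> vspan N ((\<lambda>j. A ^\<^sub>m (i + j) *\<^sub>v col B c) ` {..<N})"
      by (rule krylov_shift[OF A col_carrier krylov_bounded[OF A col_carrier]])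
    then have "x \<in> (\<lambda>v. C *\<^sub>v v) ` vspan N ((\<lambda>j. A ^\<^sub>m (i + j) *\<^sub>v col B c) ` {..<N})"
      using x by auto
    also have "\<dots> = vspan n ((\<lambda>v. C *\<^sub>v v) ` (\<lambda>j. A ^\<^sub>m (i + j) *\<^sub>v col B c) ` {..<N})"
      using C power_col_carrier by (intro mult_mat_vec_vspan) auto
    also have "\<dots> \<subseteq> vspan n ?G"
      using x(3) by (intro vspan_mono) (auto simp: markov_col_def)
    finally show "x \<in> vspan n ?G" .
  qed
  then show "vspan n (markov_tail A B C m i) \<subseteq> vspan n (set (cols (C * A ^\<^sub>m i * ctrb_mat A B N m)))"
    unfolding cols_output_ctrb using G by (rule vspan_minimal)
qed

abbreviation "orank i \<equiv> mrank n (C * A ^\<^sub>m i * ctrb_mat A B N m)"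

lemma orank_basis:
  obtains S where "finite S" "S \<subseteq> carrier_vec n" "\<not> module.lin_dep class_ring (module_vec TYPE(real) n) S"
    "vspan n S = vspan n (markov_tail A B C m i)" "card S = orank i"
proof -
  interpret vec_space "TYPE(real)" n .
  obtain S where S: "S \<subseteq> set (cols (C * A ^\<^sub>m i * ctrb_mat A B N m))" "lin_indpt S"
    "span S = span (set (cols (C * A ^\<^sub>m i * ctrb_mat A B N m)))"
    "card S = rank (C * A ^\<^sub>m i * ctrb_mat A B N m)"
    using rank_basis[OF output_ctrb_carrier] by blast
  have "set (cols (C * A ^\<^sub>m i * ctrb_mat A B N m)) \<subseteq> carrier_vec n"
    using cols_dim output_ctrb_carrier[of i] by (metis carrier_matD(1))
  then show ?thesis using S that[of S] vspan_cols_output_ctrb finite_subset[OF S(1)]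
    unfolding mrank_def by auto
qed

lemma orank_full_iff: "orank i = n \<longleftrightarrow> carrier_vec n \<subseteq> vspan n (markov_tail A B C m i)"
proof -
  interpret vec_space "TYPE(real)" n .
  obtain S where S: "finite S" "S \<subseteq> carrier_vec n" "lin_indpt S"
    "span S = span (markov_tail A B C m i)" "card S = orank i"
    using orank_basis .
  show ?thesis
  proof
    assume "orank i = n"
    then have "basis S" using dim_li_is_basis[of S] S fin_dim dim_is_n by simp
    then show "carrier_vec n \<subseteq> vspan n (markov_tail A B C m i)" using S(4) unfolding basis_def by simp
  next
    assume "carrier_vec n \<subseteq> vspan n (markov_tail A B C m i)"
    then have "span S = carrier_vec n" using S(4) vspan_carrier[OF S(2)] by auto
    then have "basis S" using S unfolding basis_def by simp
    then show "orank i = n" using dim_basis[of S] S dim_is_n by simp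
  qed
qed

section \<open>Necessity: counting what the last sparse inputs must contribute\<close>

text \<open>Replacing the tail by a basis of V_i turns the spanning set into a finite one, of size
  at most \<open>orank i + card T\<close>.\<close>

lemma dim_le_orank_plus_card:
  assumes "carrier_vec n \<subseteq> vspan n (markov_tail A B C m i \<union> T)" "finite T" "T \<subseteq> carrier_vec n"
  shows "n \<le> orank i + card T"
proof -
  interpret vec_space "TYPE(real)" n .
  obtain S where S: "finite S" "S \<subseteq> carrier_vec n" "lin_indpt S"
    "span S = span (markov_tail A B C m i)" "card S = orank i"
    using orank_basis .
  have "span (S \<union> T) = span (markov_tail A B C m i \<union> T)"
    using span_Un[of S "markov_tail A B C m i" T T] S assms markov_tail_carrier by simp
  then have "gen_set (S \<union> T)" using assms(1) span_closed[of "S \<union> T"] S assms(3) by auto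
  then have "n \<le> card (S \<union> T)" using gen_ge_dim[of "S \<union> T"] S assms dim_is_n by simp
  then show ?thesis using card_Un_le[of S T] S by linarith
qed

lemma sum_Rdef: "(\<Sum>j\<le>i. real_of_int (Rdef A B C N m n j)) = real (orank 0) - real (orank (Suc i))"
  by (induction i) (auto simp: Rdef_def)

lemma output_state_in_vspan:
  assumes "\<And>k. k \<in> {1..K} \<Longrightarrow> u k \<in> carrier_vec m"
  shows "C *\<^sub>v state A B (0\<^sub>v N) u K \<in>
    vspan n {markov_col A B C j c | j c. j < K \<and> c < m \<and> u (K - j) $ c \<noteq> 0}"
proof -
  let ?S = "{A ^\<^sub>m j *\<^sub>v col B c | j c. j < K \<and> c < m \<and> u (K - j) $ c \<noteq> 0}"
  have "C *\<^sub>v state A B (0\<^sub>v N) u K \<in> (\<lambda>v. C *\<^sub>v v) ` vspan N ?S"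
    using state_in_vspan[of A N B m K u, OF A B assms] by (rule imageI)
  also have "\<dots> = vspan n ((\<lambda>v. C *\<^sub>v v) ` ?S)"
    using power_col_carrier by (intro mult_mat_vec_vspan[OF C]) blast
  also have "(\<lambda>v. C *\<^sub>v v) ` ?S = {markov_col A B C j c | j c. j < K \<and> c < m \<and> u (K - j) $ c \<noteq> 0}"
    unfolding markov_col_def by blast
  finally show ?thesis .
qed

text \<open>Starting from state 0, lags of at least i contribute to V_i, while each of the i smaller
  lags contributes at most s columns. Finitely many support patterns cover R^n, so a single one
  already spans it.\<close>

lemma sparse_controllable_imp_spanning:
  assumes "output_sparse_controllable A B C N m n s"
  shows "\<exists>T. finite T \<and> card T \<le> s * i \<and> T \<subseteq> carrier_vec n \<and>
    carrier_vec n \<subseteq> vspan n (markov_tail A B C m i \<union> T)"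
proof -
  obtain K where K: "\<And>y. y \<in> carrier_vec n \<Longrightarrow> \<exists>u. (\<forall>k\<in>{1..K}. u k \<in> carrier_vec m \<and> sparse_vec s (u k))
      \<and> C *\<^sub>v state A B (0\<^sub>v N) u K = y"
    using assms zero_carrier_vec[of N] unfolding output_sparse_controllable_def by blast
  \<comment> \<open>Extensional functions make the set of patterns for the lags below i
    finite.\<close>
  define supports where "supports = ({..<i} \<rightarrow>\<^sub>E {S. S \<subseteq> {..<m} \<and> card S \<le> s})"
  define T where "T P = (\<Union>j<i. markov_col A B C j ` P j)" for P :: "nat \<Rightarrow> nat set"
  have fin: "finite supports" unfolding supports_def by (intro finite_PiE) auto
  have Tc: "T P \<subseteq> carrier_vec n" for P unfolding T_def using markov_col_carrier by blast
  have cover: "carrier_vec n \<subseteq> (\<Union>X\<in>(\<lambda>P. markov_tail A B C m i \<union> T P) ` supports. vspan n X)"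
  proof
    fix y :: "real vec" assume "y \<in> carrier_vec n"
    then obtain u where u: "\<And>k. k \<in> {1..K} \<Longrightarrow> u k \<in> carrier_vec m \<and> sparse_vec s (u k)"
      and y: "C *\<^sub>v state A B (0\<^sub>v N) u K = y" using K by blast
    \<comment> \<open>\<open>K\<close> may be smaller than \<open>i\<close>; lags with no input then
      get the empty support.\<close>
    define P where "P = (\<lambda>j\<in>{..<i}. if j < K then {c. c < m \<and> u (K - j) $ c \<noteq> 0} else {})"
    have "P \<in> supports"
      unfolding supports_def P_def
    proof (rule restrict_PiE_iff[THEN iffD2], intro ballI)
      fix j assume "j \<in> {..<i}"
      show "(if j < K then {c. c < m \<and> u (K - j) $ c \<noteq> 0} else {}) \<in> {S. S \<subseteq> {..<m} \<and> card S \<le> s}"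
      proof (cases "j < K")
        case True
        then have "u (K - j) \<in> carrier_vec m \<and> sparse_vec s (u (K - j))" by (intro u) auto
        then have "dim_vec (u (K - j)) = m" "sparse_vec s (u (K - j))" using carrier_vecD by blast+
        then have "card {c. c < m \<and> u (K - j) $ c \<noteq> 0} \<le> s" unfolding sparse_vec_def by simp
        then show ?thesis using True by auto
      qed simp
    qed
    moreover have "y \<in> vspan n (markov_tail A B C m i \<union> T P)"
    proof -
      have "{markov_col A B C j c | j c. j < K \<and> c < m \<and> u (K - j) $ c \<noteq> 0} \<subseteq> markov_tail A B C m i \<union> T P"
      proof
        fix x assume "x \<in> {markov_col A B C j c | j c. j < K \<and> c < m \<and> u (K - j) $ c \<noteq> 0}"
        then obtain j c where x: "x = markov_col A B C j c" "j < K" "c < m" "u (K - j) $ c \<noteq> 0" by blast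
        show "x \<in> markov_tail A B C m i \<union> T P"
        proof (cases "j < i")
          case True
          then have "c \<in> P j" using x by (simp add: P_def)
          then show ?thesis using x True unfolding T_def by blast
        next
          case False
          then have "i \<le> j" by simp
          then show ?thesis using x unfolding markov_tail_def by blast
        qed
      qed
      then show ?thesis using output_state_in_vspan[of K u, OF conjunct1[OF u]] y vspan_mono by blast
    qed
    ultimately show "y \<in> (\<Union>X\<in>(\<lambda>P. markov_tail A B C m i \<union> T P) ` supports. vspan n X)" by blast
  qed
  have "\<exists>X\<in>(\<lambda>P. markov_tail A B C m i \<union> T P) ` supports. carrier_vec n \<subseteq> vspan n X"
    using fin Tc markov_tail_carrier cover by (intro finite_union_vspan_eq_carrier) auto
  then obtain P where P: "P \<in> supports" "carrier_vec n \<subseteq> vspan n (markov_tail A B C m i \<union> T P)" by blast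
  have Pj: "finite (P j)" "card (P j) \<le> s" if "j < i" for j
    using P(1) that finite_subset[of "P j" "{..<m}"] unfolding supports_def by auto
  have "card (T P) \<le> (\<Sum>j<i. card (markov_col A B C j ` P j))"
    unfolding T_def by (rule card_UN_le) simp
  also have "\<dots> \<le> (\<Sum>j<i. s)"
    using Pj card_image_le le_trans by (intro sum_mono) fast
  finally have "card (T P) \<le> s * i" by (simp add: mult.commute)
  moreover have "finite (T P)" unfolding T_def using Pj by blast
  ultimately show ?thesis using P(2) Tc by blast
qed

section \<open>Sufficiency: choosing supports lag by lag\<close>

text \<open>A basis \<open>X\<close> of V_{i+1} is extended to span V_i by columns of C A^i B. The
  exchange bound limits the number of added columns to R_i.\<close>

lemma vspan_tail_step:
  assumes "Rdef A B C N m n i \<le> int s"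
  shows "\<exists>S \<subseteq> {..<m}. card S \<le> s \<and>
    vspan n (markov_tail A B C m i) \<subseteq> vspan n (markov_col A B C i ` S \<union> markov_tail A B C m (Suc i))"
proof -
  interpret vec_space "TYPE(real)" n .
  let ?T = "markov_col A B C i ` {..<m}"
  obtain X where X: "finite X" "X \<subseteq> carrier_vec n" "lin_indpt X"
    "span X = span (markov_tail A B C m (Suc i))" "card X = orank (Suc i)"
    using orank_basis .
  obtain Y where Y: "finite Y" "Y \<subseteq> carrier_vec n" "lin_indpt Y"
    "span Y = span (markov_tail A B C m i)" "card Y = orank i"
    using orank_basis .
  have Tc: "?T \<subseteq> carrier_vec n" using markov_col_carrier by blast
  have tail: "markov_tail A B C m i = markov_tail A B C m (Suc i) \<union> ?T"
  proof -
    have "i \<le> j \<longleftrightarrow> Suc i \<le> j \<or> j = i" for j by auto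
    then show ?thesis unfolding markov_tail_def by blast
  qed
  obtain T' where T': "T' \<subseteq> ?T" "X \<inter> T' = {}" "lin_indpt (X \<union> T')" "span (X \<union> T') = span (X \<union> ?T)"
    using exists_indep_extension[of ?T X] X Tc by blast
  have T'c: "T' \<subseteq> carrier_vec n" "finite T'" using T'(1) Tc finite_subset[OF T'(1)] by auto
  have e: "span (X \<union> ?T) = span (markov_tail A B C m i)"
    unfolding tail using span_Un[of X "markov_tail A B C m (Suc i)" ?T ?T] X Tc markov_tail_carrier by simp
  have "X \<union> T' \<subseteq> span Y"
    using in_own_span[of "X \<union> T'"] X(2) T'c(1) unfolding T'(4) e Y(4) by simp
  then have "card (X \<union> T') \<le> card Y" using indep_card_le(2)[OF T'(3)] Y by blast
  then have "card X + card T' \<le> card Y" using card_Un_disjoint[OF X(1) T'c(2) T'(2)] by simp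
  then have le: "card T' \<le> s" using assms X(5) Y(5) unfolding Rdef_def by linarith
  \<comment> \<open>Different indices may give equal columns; one index is picked per vector of
    \<open>T'\<close>, so that \<open>S\<close> is no larger than \<open>T'\<close>.\<close>
  obtain S where S: "S \<subseteq> {..<m}" "inj_on (markov_col A B C i) S" "T' = markov_col A B C i ` S"
    using T'(1) unfolding subset_image_inj by blast
  have "card S \<le> s" using le S card_image by metis
  moreover have "span (X \<union> T') = span (markov_tail A B C m (Suc i) \<union> T')"
    using span_Un[of X "markov_tail A B C m (Suc i)" T' T'] X T'c markov_tail_carrier by simp
  then have "span (markov_tail A B C m i) \<subseteq> span (T' \<union> markov_tail A B C m (Suc i))"
    using T'(4) e by (simp add: Un_commute)
  ultimately show ?thesis using S by blast
qed

text \<open>One support pattern serves all targets: the input steers 0 to a state whose output is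
  \<open>yf\<close> minus the free response \<open>d\<close>.\<close>

lemma spanning_imp_sparse_controllable:
  assumes K: "0 < K" and P: "\<And>j. P j \<subseteq> {..<m}" "\<And>j. card (P j) \<le> s"
    and span: "carrier_vec n \<subseteq> vspan n {markov_col A B C j c | j c. j < K \<and> c \<in> P j}"
  shows "output_sparse_controllable A B C N m n s"
  unfolding output_sparse_controllable_def
proof (intro exI[of _ K] conjI ballI K)
  fix x0 yf :: "real vec" assume x0: "x0 \<in> carrier_vec N" and yf: "yf \<in> carrier_vec n"
  let ?S = "{A ^\<^sub>m j *\<^sub>v col B c | j c. j < K \<and> c \<in> P j}"
  define d where "d = C *\<^sub>v (A ^\<^sub>m K *\<^sub>v x0)"
  have Ax: "A ^\<^sub>m K *\<^sub>v x0 \<in> carrier_vec N" using A x0 by (rule pow_mat_vec_carrier)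
  have d: "d \<in> carrier_vec n" unfolding d_def using C Ax by (rule mult_mat_vec_carrier)
  have "(\<lambda>v. C *\<^sub>v v) ` ?S = {markov_col A B C j c | j c. j < K \<and> c \<in> P j}"
    unfolding markov_col_def by blast
  moreover have "(\<lambda>v. C *\<^sub>v v) ` vspan N ?S = vspan n ((\<lambda>v. C *\<^sub>v v) ` ?S)"
    using power_col_carrier by (intro mult_mat_vec_vspan[OF C]) blast
  ultimately have im: "(\<lambda>v. C *\<^sub>v v) ` vspan N ?S = vspan n {markov_col A B C j c | j c. j < K \<and> c \<in> P j}"
    by simp
  have "yf - d \<in> carrier_vec n" using yf d by simp
  then have "yf - d \<in> (\<lambda>v. C *\<^sub>v v) ` vspan N ?S" unfolding im using span by (rule rev_subsetD)
  then obtain v where v: "yf - d = C *\<^sub>v v" "v \<in> vspan N ?S" by (rule imageE)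
  obtain u where u: "\<And>k. u k \<in> carrier_vec m" "\<And>k. {i. i < m \<and> u k $ i \<noteq> 0} \<subseteq> P (K - k)"
    and st: "state A B (0\<^sub>v N) u K = v"
    using vspan_reached_by_state[OF A B P(1) v(2)] by blast
  have vc: "v \<in> carrier_vec N" using state_carrier[OF A B zero_carrier_vec, of u K] st by simp
  have "state A B x0 u K = A ^\<^sub>m K *\<^sub>v x0 + v"
    using state_decompose[of A N B m x0 u K, OF A B x0 u(1)] st by simp
  then have "C *\<^sub>v state A B x0 u K = d + (yf - d)"
    using mult_add_distrib_mat_vec[OF C Ax vc] v(1) d_def by simp
  also have "\<dots> = yf" using d yf by (intro eq_vecI) auto
  finally have "C *\<^sub>v state A B x0 u K = yf" .
  moreover have "sparse_vec s (u k)" for k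
  proof -
    have "finite (P (K - k))" using P(1) by (rule finite_subset) simp
    then have "card {i. i < m \<and> u k $ i \<noteq> 0} \<le> card (P (K - k))" using u(2) by (rule card_mono)
    then show ?thesis
      using P(2)[of "K - k"] unfolding sparse_vec_def carrier_vecD[OF u(1)] by (rule le_trans)
  qed
  ultimately show "\<exists>u. (\<forall>k\<in>{1..K}. u k \<in> carrier_vec m \<and> sparse_vec s (u k)) \<and> C *\<^sub>v state A B x0 u K = yf"
    using u(1) by (intro exI[of _ u]) simp
qed

lemma full_support_controllable:
  assumes "0 < N" "m \<le> s" and full: "carrier_vec n \<subseteq> vspan n (markov_tail A B C m 0)"
  shows "output_sparse_controllable A B C N m n s"
proof (rule spanning_imp_sparse_controllable[OF assms(1), where P = "\<lambda>_. {..<m}"])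
  have "{markov_col A B C (0 + j) c | j c. j < N \<and> c < m} = {markov_col A B C j c | j c. j < N \<and> c \<in> {..<m}}"
    by simp
  then show "carrier_vec n \<subseteq> vspan n {markov_col A B C j c | j c. j < N \<and> c \<in> {..<m}}"
    using full vspan_cols_output_ctrb[of 0] cols_output_ctrb[of 0] by simp
qed (use assms(2) in auto)

text \<open>Lags below N recover V_0 from V_N one drop at a time; V_N itself comes from later lags
  with one active entry each.\<close>

lemma rank_drop_controllable:
  assumes N: "0 < N" and s: "0 < s" and R: "\<And>i. i < N \<Longrightarrow> Rdef A B C N m n i \<le> int s"
    and full: "carrier_vec n \<subseteq> vspan n (markov_tail A B C m 0)"
  shows "output_sparse_controllable A B C N m n s"
proof -
  have "\<exists>S. i < N \<longrightarrow> S \<subseteq> {..<m} \<and> card S \<le> s \<and>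
    vspan n (markov_tail A B C m i) \<subseteq> vspan n (markov_col A B C i ` S \<union> markov_tail A B C m (Suc i))" for i
    using vspan_tail_step R by meson
  then obtain S where S: "\<And>i. i < N \<Longrightarrow> S i \<subseteq> {..<m}" "\<And>i. i < N \<Longrightarrow> card (S i) \<le> s"
    "\<And>i. i < N \<Longrightarrow> vspan n (markov_tail A B C m i) \<subseteq>
      vspan n (markov_col A B C i ` S i \<union> markov_tail A B C m (Suc i))"
    by metis
  define K where "K = N + m * N"
  \<comment> \<open>From lag N on, block number c consists of N consecutive lags and activates
    column c alone. A singleton support is allowed since s > 0.\<close>
  define P where "P j = (if j < N then S j else if j < K then {(j - N) div N} else {})" for j
  let ?F = "{markov_col A B C j c | j c. j < K \<and> c \<in> P j}"
  have Fc: "?F \<subseteq> carrier_vec n" using markov_col_carrier by blast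
  have "(j - N) div N < m" if "\<not> j < N" "j < K" for j
    using that by (intro less_mult_imp_div_less) (auto simp: K_def)
  then have P1: "P j \<subseteq> {..<m}" for j using S(1) by (auto simp: P_def)
  have P2: "card (P j) \<le> s" for j using S(2) s by (auto simp: P_def)
  have last: "markov_tail A B C m N \<subseteq> vspan n ?F"
  proof
    fix x assume "x \<in> markov_tail A B C m N"
    then obtain j c where x: "x = C *\<^sub>v (A ^\<^sub>m j *\<^sub>v col B c)" "N \<le> j" "c < m"
      unfolding markov_tail_def markov_col_def by auto
    \<comment> \<open>The first lag of the block reserved for column \<open>c\<close>.\<close>
    let ?L = "N + c * N"
    have sub: "(\<lambda>v. C *\<^sub>v v) ` (\<lambda>j. A ^\<^sub>m (?L + j) *\<^sub>v col B c) ` {..<N} \<subseteq> ?F"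
    proof
      fix y assume "y \<in> (\<lambda>v. C *\<^sub>v v) ` (\<lambda>j. A ^\<^sub>m (?L + j) *\<^sub>v col B c) ` {..<N}"
      then obtain r where r: "r < N" "y = markov_col A B C (?L + r) c"
        unfolding markov_col_def by blast
      have "c * N + r < Suc c * N" using r by simp
      also have "\<dots> \<le> m * N" using x(3) by (intro mult_le_mono1) simp
      finally have "?L + r < K" unfolding K_def by simp
      moreover have "c \<in> P (?L + r)" using \<open>?L + r < K\<close> r(1) N unfolding P_def by simp
      ultimately show "y \<in> ?F" using r(2) by blast
    qed
    have "x \<in> (\<lambda>v. C *\<^sub>v v) ` vspan N ((\<lambda>j. A ^\<^sub>m (?L + j) *\<^sub>v col B c) ` {..<N})"
      using x krylov_backward[OF A col_carrier x(2)] by blast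
    also have "\<dots> = vspan n ((\<lambda>v. C *\<^sub>v v) ` (\<lambda>j. A ^\<^sub>m (?L + j) *\<^sub>v col B c) ` {..<N})"
      using power_col_carrier by (intro mult_mat_vec_vspan[OF C]) blast
    also have "\<dots> \<subseteq> vspan n ?F" using sub by (rule vspan_mono)
    finally show "x \<in> vspan n ?F" .
  qed
  \<comment> \<open>Descent from V_N to V_0; once k reaches N the truncated difference stays at
    0.\<close>
  have "vspan n (markov_tail A B C m (N - k)) \<subseteq> vspan n ?F" for k
  proof (induction k)
    case 0
    then show ?case using vspan_minimal[OF last Fc] by simp
  next
    case (Suc k)
    show ?case
    proof (cases "k < N")
      case True
      define i where "i = N - Suc k"
      have i: "i < N" "N - k = Suc i" using True i_def by auto
      have "markov_col A B C i ` S i \<subseteq> ?F"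
      proof -
        have "i < K" "P i = S i" using i(1) unfolding K_def P_def by auto
        then show ?thesis by blast
      qed
      then have "markov_col A B C i ` S i \<subseteq> vspan n ?F" using vspan_superset[OF Fc] by blast
      moreover have "markov_tail A B C m (Suc i) \<subseteq> vspan n ?F"
        using Suc vspan_superset[OF markov_tail_carrier, of "Suc i"] unfolding i(2) by blast
      ultimately have "vspan n (markov_col A B C i ` S i \<union> markov_tail A B C m (Suc i)) \<subseteq> vspan n ?F"
        using Fc by (intro vspan_minimal) auto
      then show ?thesis using S(3)[OF i(1)] unfolding i_def by blast
    next
      case False
      then show ?thesis using Suc by simp
    qed
  qed
  from this[of N] have "carrier_vec n \<subseteq> vspan n ?F" using full by simp
  then show ?thesis
    using spanning_imp_sparse_controllable[of K P s] P1 P2 N unfolding K_def by blast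
qed

end

theorem theorem1:
  fixes A B C :: "real mat" and N m n s :: nat
  assumes "A \<in> carrier_mat N N" and "B \<in> carrier_mat N m" and "C \<in> carrier_mat n N"
    and "0 < N" and "0 < s" and "s \<le> m"
  shows "(output_sparse_controllable A B C N m n s \<longrightarrow>
            mrank n (C * ctrb_mat A B N m) = n \<and>
            Max ((\<lambda>i. (\<Sum>j\<le>i. real_of_int (Rdef A B C N m n j)) / real (i + 1)) ` {0..N-1})
              \<le> real s)
       \<and> (mrank n (C * ctrb_mat A B N m) = n \<and>
            min (int m) (Max ((\<lambda>i. Rdef A B C N m n i) ` {0..N-1})) \<le> int s
          \<longrightarrow> output_sparse_controllable A B C N m n s)"
proof -
  note ABC = assms(1-3)
  let ?orank = "\<lambda>i. mrank n (C * A ^\<^sub>m i * ctrb_mat A B N m)"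
  have "C * A ^\<^sub>m 0 = C" using assms by simp
  then have rank0: "mrank n (C * ctrb_mat A B N m) = ?orank 0" by simp
  show ?thesis
    unfolding rank0
  proof (intro conjI impI)
    assume ctrl: "output_sparse_controllable A B C N m n s"
    then have full: "carrier_vec n \<subseteq> vspan n (markov_tail A B C m 0)"
      \<comment> \<open>With i = 0 the extra set has at most 0 elements, so V_0 alone is
        R^n.\<close>
      using sparse_controllable_imp_spanning[OF ABC ctrl, of 0] by auto
    then show rank: "?orank 0 = n" using orank_full_iff[OF ABC, of 0] by simp
    have "(\<Sum>j\<le>i. real_of_int (Rdef A B C N m n j)) / real (i + 1) \<le> real s" for i
    proof -
      \<comment> \<open>The average over R_0, ..., R_i concerns the i+1 lags from 0 to i, hence the
        tail starting at i+1.\<close>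
      obtain T where T: "finite T" "card T \<le> s * Suc i" "T \<subseteq> carrier_vec n"
        "carrier_vec n \<subseteq> vspan n (markov_tail A B C m (Suc i) \<union> T)"
        using sparse_controllable_imp_spanning[OF ABC ctrl, of "Suc i"] by blast
      have "n \<le> ?orank (Suc i) + s * Suc i"
        using dim_le_orank_plus_card[OF ABC T(4,1,3)] T(2) by linarith
      then have "real n \<le> real (?orank (Suc i)) + real s * real (i + 1)"
        by (metis Suc_eq_plus1 of_nat_add of_nat_le_iff of_nat_mult)
      then have "(\<Sum>j\<le>i. real_of_int (Rdef A B C N m n j)) \<le> real s * real (i + 1)"
        unfolding sum_Rdef[OF ABC] rank by linarith
      then show ?thesis by (simp add: pos_divide_le_eq del: of_nat_Suc of_nat_add)
    qed
    then show "Max ((\<lambda>i. (\<Sum>j\<le>i. real_of_int (Rdef A B C N m n j)) / real (i + 1)) ` {0..N-1}) \<le> real s"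
      by (subst Max_le_iff) auto
  next
    assume a: "?orank 0 = n \<and> min (int m) (Max ((\<lambda>i. Rdef A B C N m n i) ` {0..N-1})) \<le> int s"
    then have full: "carrier_vec n \<subseteq> vspan n (markov_tail A B C m 0)"
      using orank_full_iff[OF ABC, of 0] by simp
    \<comment> \<open>The minimum splits the claim: either sparsity is no restriction, or every
      single drop R_i is at most s.\<close>
    from a consider "m \<le> s" | "Max ((\<lambda>i. Rdef A B C N m n i) ` {0..N-1}) \<le> int s" by linarith
    then show "output_sparse_controllable A B C N m n s"
    proof cases
      case 1
      then show ?thesis using full_support_controllable[OF ABC assms(4) _ full] by blast
    next
      case 2
      then have "Rdef A B C N m n i \<le> int s" if "i < N" for i
        using that by (subst (asm) Max_le_iff) auto
      then show ?thesis using rank_drop_controllable[OF ABC assms(4,5) _ full] by blast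
    qed
  qed
qed

end
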